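(* Assume that $P(x,y)>0$ for all $x,y\in X$ and that there is a constant $C_*\ge 1$ with $P_2(x,y)\le C_*P(x,y)$ for all $x,y\in X$; that $\inf_{x\in X}P(x,x)>0$; that $\sup_{x,y\in X}P(x,y)/\mu(y)<\infty$; and that the potential $V$ is confining. Let $n_0\in\{2,3,\dots\}$. The following conditions are equivalent: (i) the semigroup $\{\mathcal U_n:n\in\mathbb N_0\}$ is aIUC($n_0$); (ii) the semigroup $\{\widehat{\mathcal U}_n:n\in\mathbb N_0\}$ is aIUC($n_0$); (iii) for every fixed $x_0\in X$ there is a constant $C=C(n_0,x_0)>0$ such that $$\frac{C}{V(x)^{n_0-1}}\le P(x,x_0)P(x_0,x),\quad x\in X.$$
   Context: $X$ is a countably infinite set, $\mathbb N=\{1,2,\dots\}$, $\mathbb N_0=\mathbb N\cup\{0\}$. $P:X\times X\to[0,1]$ is a (sub-)probability kernel, i.e. $\sum_{y\in X}P(x,y)\le1$ for all $x$. It is assumed throughout that there are a (sub-)probability kernel $\widehat P:X\times X\to[0,1]$ and a measure $\mu:X\to(0,\infty)$ with $\mu(x)P(x,y)=\mu(y)\widehat P(y,x)$ for all $x,y\in X$. Put $p(x,y)=P(x,y)/\mu(y)$ and $P_2(x,y)=\sum_{z\in X}P(x,z)P(z,y)$. A potential is a function $V:X\to(0,\infty)$ with $\inf_{x\in X}V(x)>0$ (standing assumption). It is confining if for every $M\in\mathbb N$ there is a finite set $B_M\subset X$ with $V(x)\ge M$ for all $x\in X\setminus B_M$. Let $\mathcal U f(x)=\frac1{V(x)}\sum_{y}P(x,y)f(y)$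 and $\widehat{\mathcal U}f(x)=\sum_y\widehat P(x,y)\frac1{V(y)}f(y)$; these are mutually adjoint on $\ell^2(\mu)$. Let $\mathcal U_n=\mathcal U^n$, $\widehat{\mathcal U}_n=\widehat{\mathcal U}^n$, with kernels with respect to $\mu$ given by $u_1(x,y)=p(x,y)/V(x)$, $u_{n+1}(x,y)=\sum_zu_n(x,z)u_1(z,y)\mu(z)$ and $\widehat u_n(x,y)=u_n(y,x)$. Under the hypotheses of the claim, $\mathcal U,\widehat{\mathcal U}$ are compact on $\ell^2(\mu)$ and $\lambda_0:=\sup_{\lambda\in\sigma(\mathcal U)}|\lambda|=\sup_{\lambda\in\sigma(\widehat{\mathcal U})}|\lambda|>0$ is a simple eigenvalue of both; $\varphi_0,\widehat\varphi_0$ denote the corresponding strictly positive eigenfunctions, $\mathcal U\varphi_0=\lambda_0\varphi_0$, $\widehat{\mathcal U}\widehat\varphi_0=\lambda_0\widehat\varphi_0$, normalized by $\|\varphi_0\|_{\ell^2(\mu)}=\|\widehat\varphi_0\|_{\ell^2(\mu)}=1$. Let $\nu(x)=\varphi_0(x)\widehat\varphi_0(x)\mu(x)$ (a finite measure) and define the intrinsic semigroups $\mathcal Q_nf=\lambda_0^{-n}\varphi_0^{-1}\,\mathcal U_n(f\varphi_0)$, $\widehat{\mathcal Q}_nf=\lambda_0^{-n}\widehat\varphi_0^{-1}\,\widehat{\mathcal U}_n(f\widehat\varphi_0)$. $\{\mathcal U_n\}$ is asymptotically intrinsically ultracontractive with index $n_0$, aIUC($n_0$), if $\mathcal Q_{n_0}:\ell^1(\nu)\to\ell^\infty(\nu)$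 is bounded; equivalently $\sup_{x,y}\frac{u_{n_0}(x,y)}{\lambda_0^{n_0}\varphi_0(x)\widehat\varphi_0(y)}<\infty$. $\{\widehat{\mathcal U}_n\}$ is aIUC($n_0$) if $\widehat{\mathcal Q}_{n_0}:\ell^1(\nu)\to\ell^\infty(\nu)$ is bounded. *)

theory Defs
  imports "HOL-Analysis.Analysis"
begin

text \<open>The state space \<open>X\<close> is a type. The sum of the row is required to exist, because an
  infinite sum that diverges has the value 0.\<close>

definition subprob_kernel :: "('a \<Rightarrow> 'a \<Rightarrow> real) \<Rightarrow> bool" where
  "subprob_kernel P \<longleftrightarrow>
     (\<forall>x y. 0 \<le> P x y \<and> P x y \<le> 1) \<and>
     (\<forall>x. P x summable_on UNIV \<and> (\<Sum>\<^sub>\<infinity>y. P x y) \<le> 1)"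

definition two_step :: "('a \<Rightarrow> 'a \<Rightarrow> real) \<Rightarrow> 'a \<Rightarrow> 'a \<Rightarrow> real" where
  "two_step P x y = (\<Sum>\<^sub>\<infinity>z. P x z * P z y)"

definition potential :: "('a \<Rightarrow> real) \<Rightarrow> bool" where
  "potential V \<longleftrightarrow> (\<forall>x. 0 < V x) \<and> 0 < (INF x. V x)"

definition confining :: "('a \<Rightarrow> real) \<Rightarrow> bool" where
  "confining V \<longleftrightarrow> (\<forall>M::nat. M \<ge> 1 \<longrightarrow> (\<exists>B. finite B \<and> (\<forall>x. x \<notin> B \<longrightarrow> real M \<le> V x)))"

text \<open>The operators act on real functions (eigenfunctions) as well as on complex ones
  (spectrum, boundedness); hence the scalar multiplication.\<close>

definition fk_op ::
  "('a \<Rightarrow> 'a \<Rightarrow> real) \<Rightarrow> ('a \<Rightarrow> real) \<Rightarrow> ('a \<Rightarrow> 'b::real_normed_vector) \<Rightarrow> 'a \<Rightarrow> 'b" where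
  "fk_op P V f x = (1 / V x) *\<^sub>R (\<Sum>\<^sub>\<infinity>y. P x y *\<^sub>R f y)"

definition dual_fk_op ::
  "('a \<Rightarrow> 'a \<Rightarrow> real) \<Rightarrow> ('a \<Rightarrow> real) \<Rightarrow> ('a \<Rightarrow> 'b::real_normed_vector) \<Rightarrow> 'a \<Rightarrow> 'b" where
  "dual_fk_op Ph V f x = (\<Sum>\<^sub>\<infinity>y. (Ph x y * (1 / V y)) *\<^sub>R f y)"

definition l1 :: "('a \<Rightarrow> real) \<Rightarrow> ('a \<Rightarrow> 'b::real_normed_vector) set" where
  "l1 \<nu> = {f. (\<lambda>x. norm (f x) * \<nu> x) summable_on UNIV}"

definition l1_norm :: "('a \<Rightarrow> real) \<Rightarrow> ('a \<Rightarrow> 'b::real_normed_vector) \<Rightarrow> real" where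
  "l1_norm \<nu> f = (\<Sum>\<^sub>\<infinity>x. norm (f x) * \<nu> x)"

definition l2 :: "('a \<Rightarrow> real) \<Rightarrow> ('a \<Rightarrow> 'b::real_normed_vector) set" where
  "l2 \<mu> = {f. (\<lambda>x. (norm (f x))\<^sup>2 * \<mu> x) summable_on UNIV}"

definition l2_norm :: "('a \<Rightarrow> real) \<Rightarrow> ('a \<Rightarrow> 'b::real_normed_vector) \<Rightarrow> real" where
  "l2_norm \<mu> f = sqrt (\<Sum>\<^sub>\<infinity>x. (norm (f x))\<^sup>2 * \<mu> x)"

text \<open>The number \<open>z\<close> lies in the resolvent set if \<open>T - z\<close> is a bijection of the complex space
  \<open>l2 \<mu>\<close> with bounded inverse; the last conjunct is the boundedness of the inverse.\<close>

definition l2_spectrum ::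
  "('a \<Rightarrow> real) \<Rightarrow> (('a \<Rightarrow> complex) \<Rightarrow> 'a \<Rightarrow> complex) \<Rightarrow> complex set" where
  "l2_spectrum \<mu> T =
     {z. \<not> (bij_betw (\<lambda>f x. T f x - z * f x) (l2 \<mu>) (l2 \<mu>) \<and>
             (\<exists>C. \<forall>f\<in>l2 \<mu>. l2_norm \<mu> f \<le> C * l2_norm \<mu> (\<lambda>x. T f x - z * f x)))}"

definition l2_spectral_radius ::
  "('a \<Rightarrow> real) \<Rightarrow> (('a \<Rightarrow> complex) \<Rightarrow> 'a \<Rightarrow> complex) \<Rightarrow> real" where
  "l2_spectral_radius \<mu> T = (SUP z\<in>l2_spectrum \<mu> T. cmod z)"

definition positive_normalized_eigenfunction ::
  "('a \<Rightarrow> real) \<Rightarrow> (('a \<Rightarrow> real) \<Rightarrow> 'a \<Rightarrow> real) \<Rightarrow> real \<Rightarrow> ('a \<Rightarrow> real) \<Rightarrow> bool" where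
  "positive_normalized_eigenfunction \<mu> T lam \<phi> \<longleftrightarrow>
     \<phi> \<in> l2 \<mu> \<and> l2_norm \<mu> \<phi> = 1 \<and> (\<forall>x. 0 < \<phi> x) \<and> (\<forall>x. T \<phi> x = lam * \<phi> x)"

definition intrinsic_measure ::
  "('a \<Rightarrow> real) \<Rightarrow> ('a \<Rightarrow> real) \<Rightarrow> ('a \<Rightarrow> real) \<Rightarrow> 'a \<Rightarrow> real" where
  "intrinsic_measure \<mu> \<phi> \<phi>h x = \<phi> x * \<phi>h x * \<mu> x"

definition intrinsic_semigroup ::
  "(('a \<Rightarrow> complex) \<Rightarrow> 'a \<Rightarrow> complex) \<Rightarrow> real \<Rightarrow> ('a \<Rightarrow> real) \<Rightarrow>
     nat \<Rightarrow> ('a \<Rightarrow> complex) \<Rightarrow> 'a \<Rightarrow> complex" where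
  "intrinsic_semigroup T lam \<phi> n f x =
     (1 / (lam ^ n * \<phi> x)) *\<^sub>R (T ^^ n) (\<lambda>y. \<phi> y *\<^sub>R f y) x"

text \<open>Boundedness of the intrinsic semigroup at time \<open>n\<close> from \<open>l1 \<nu>\<close> to the bounded functions.
  As \<open>\<nu>\<close> is strictly positive, the essential supremum with respect to \<open>\<nu>\<close> is the supremum.
  Since the dual eigenfunction satisfies its eigenvalue equation, all sums in the
  iterates converge absolutely for \<open>f\<close> in \<open>l1 \<nu>\<close>.\<close>

definition aIUC ::
  "(('a \<Rightarrow> complex) \<Rightarrow> 'a \<Rightarrow> complex) \<Rightarrow> real \<Rightarrow> ('a \<Rightarrow> real) \<Rightarrow> ('a \<Rightarrow> real) \<Rightarrow> nat \<Rightarrow> bool" where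
  "aIUC T lam \<phi> \<nu> n \<longleftrightarrow>
     (\<exists>C. \<forall>f\<in>l1 \<nu>. \<forall>x. cmod (intrinsic_semigroup T lam \<phi> n f x) \<le> C * l1_norm \<nu> f)"

end

theory Submission
  imports Defs
begin

text \<open>Let \<open>A x y = P x y / V x\<close>. Boundedness from \<open>l1 \<nu>\<close> to the bounded functions is a pointwise bound of
  the kernel of \<open>A ^ n\<close> by \<open>\<phi>0 x * \<phi>h0 y * \<mu> y\<close>. The functions \<open>S = V * \<phi>0\<close> and \<open>R = \<mu> * \<phi>h0\<close> solve the
  same equation for \<open>P\<close> and for its transpose, and the two-step bound with a confining \<open>V\<close> makes
  them comparable to \<open>P x x0\<close> and \<open>P x0 x\<close>. On the diagonal \<open>A ^ n\<close> is at least \<open>(c / V x) ^ n\<close>, which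
  gives (iii). Conversely, the product of \<open>n - 1\<close> factors \<open>1 / V\<close> along a path is at most the sum of
  their \<open>(n - 1)\<close>-st powers, so \<open>A ^ n\<close> is dominated by sums with a single intermediate point that
  carries all the weight, and (iii) splits such a sum at \<open>x0\<close>. The dual operator is a conjugate of the
  one with \<open>P\<close> transposed, and (iii) is invariant under transposition.\<close>

section \<open>Kernel powers\<close>

lemma nonneg_kernel_summable_on_product:
  fixes f :: "'a \<Rightarrow> 'b \<Rightarrow> real"
  assumes "\<And>x y. 0 \<le> f x y" "\<And>x. (f x has_sum g x) UNIV" "g summable_on UNIV"
  shows "(\<lambda>(x, y). f x y) summable_on UNIV \<times> UNIV"
  using summable_on_SigmaI[where f = "\<lambda>(x, y). f x y" and A = UNIV and B = "\<lambda>_. UNIV" and g = g]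
    assms by auto

text \<open>Nonnegativity turns iterated summability into summability on the product, where the
  order is free. Convergence of the columns is a separate conclusion because a divergent infinite
  sum silently has the value 0.\<close>

lemma tonelli_has_sum:
  fixes f :: "'a \<Rightarrow> 'b \<Rightarrow> real"
  assumes nonneg: "\<And>x y. 0 \<le> f x y"
    and rows: "\<And>x. (f x has_sum g x) UNIV"
    and total: "(g has_sum s) UNIV"
  shows "(\<lambda>x. f x y) summable_on UNIV"
    and "((\<lambda>y. \<Sum>\<^sub>\<infinity>x. f x y) has_sum s) UNIV"
proof -
  have joint: "(\<lambda>(x, y). f x y) summable_on UNIV \<times> UNIV"
    using assms has_sum_imp_summable by (intro nonneg_kernel_summable_on_product) auto
  then have swapped: "(\<lambda>(y, x). f x y) summable_on UNIV \<times> UNIV"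
    using summable_on_swap[of "\<lambda>(x, y). f x y" UNIV UNIV] by auto
  have cols: "(\<lambda>x. f x y) summable_on UNIV" for y
    using summable_on_SigmaD1[OF swapped, of y] by simp
  then show "(\<lambda>x. f x y) summable_on UNIV" .
  have "infsum g UNIV = (\<Sum>\<^sub>\<infinity>x. \<Sum>\<^sub>\<infinity>y. f x y)"
    by (simp add: infsumI[OF rows])
  also have "\<dots> = (\<Sum>\<^sub>\<infinity>y. \<Sum>\<^sub>\<infinity>x. f x y)"
    by (rule infsum_swap_banach[OF joint])
  finally have "(\<Sum>\<^sub>\<infinity>y. \<Sum>\<^sub>\<infinity>x. f x y) = s"
    using total by (simp add: infsumI)
  moreover have "(\<lambda>y. \<Sum>\<^sub>\<infinity>x. f x y) summable_on UNIV"
    using summable_on_SigmaD[OF swapped] cols by simp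
  ultimately show "((\<lambda>y. \<Sum>\<^sub>\<infinity>x. f x y) has_sum s) UNIV"
    using has_sum_infsum by fastforce
qed

lemma infsum_nonneg_ge_term:
  fixes f :: "'a \<Rightarrow> real"
  assumes "f summable_on UNIV" "\<And>x. 0 \<le> f x"
  shows "f x \<le> (\<Sum>\<^sub>\<infinity>x. f x)"
  using finite_sum_le_infsum[of f UNIV "{x}"] assms by simp

lemma infsum_if_eq:
  fixes f :: "'a \<Rightarrow> 'b::real_normed_vector"
  shows "(\<Sum>\<^sub>\<infinity>x. if x = y then f x else 0) = f y"
proof -
  have "(\<Sum>\<^sub>\<infinity>x. if x = y then f x else 0) = (\<Sum>\<^sub>\<infinity>x\<in>{y}. f x)"
    by (rule infsum_cong_neutral) auto
  then show ?thesis
    by simp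
qed

text \<open>Powers with respect to counting measure: for \<open>A x y = P x y / V x\<close> and
  \<open>n \<ge> 1\<close> the entry is the kernel \<open>u_n (x, y)\<close> multiplied by
  \<open>\<mu> y\<close>.\<close>

primrec kernel_pow :: "('a \<Rightarrow> 'a \<Rightarrow> real) \<Rightarrow> nat \<Rightarrow> 'a \<Rightarrow> 'a \<Rightarrow> real" where
  "kernel_pow A 0 x y = (if x = y then 1 else 0)"
| "kernel_pow A (Suc n) x y = (\<Sum>\<^sub>\<infinity>z. A x z * kernel_pow A n z y)"

lemma kernel_pow_nonneg:
  assumes "\<And>x y. 0 \<le> A x y"
  shows "0 \<le> kernel_pow A n x y"
  by (induction n arbitrary: x) (auto intro!: infsum_nonneg simp: assms)

lemma kernel_pow_1: "kernel_pow A (Suc 0) x y = A x y"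
proof -
  have "(\<lambda>z. A x z * (if z = y then 1 else 0)) = (\<lambda>z. if z = y then A x z else 0)"
    by auto
  then show ?thesis
    by (simp add: infsum_if_eq)
qed

text \<open>Along a path the factors \<open>h z\<close> of the intermediate points cancel. This
  relates the dual operator to the transposed kernel.\<close>

lemma kernel_pow_conjugate:
  assumes "\<And>x. h x \<noteq> 0"
  shows "kernel_pow (\<lambda>x y. h y / h x * A x y) n x y = h y / h x * kernel_pow A n x y"
proof (induction n arbitrary: x)
  case 0
  then show ?case
    using assms by auto
next
  case (Suc n)
  have "(\<Sum>\<^sub>\<infinity>z. h z / h x * A x z * (h y / h z * kernel_pow A n z y))
      = (\<Sum>\<^sub>\<infinity>z. h y / h x * (A x z * kernel_pow A n z y))"
    using assms by (intro infsum_cong) (simp add: field_simps)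
  then show ?case
    by (simp add: Suc infsum_cmult_right' del: times_divide_eq_left)
qed

section \<open>Kernels with a positive left eigenfunction\<close>

locale left_eigen =
  fixes A :: "'a \<Rightarrow> 'a \<Rightarrow> real" and w :: "'a \<Rightarrow> real" and lam :: real
  assumes A_nonneg: "0 \<le> A x y"
    and w_pos: "0 < w x"
    and left_eigen: "((\<lambda>x. w x * A x y) has_sum lam * w y) UNIV"
begin

text \<open>Weighting by \<open>w x\<close> and summing over \<open>x\<close> first produces a
  factor \<open>lam\<close>, so the other order of summation converges as well. The two claims go
  together: the next power is meaningful only once its defining sums converge.\<close>

lemma kernel_pow_left_eigen: "((\<lambda>x. w x * kernel_pow A n x y) has_sum lam ^ n * w y) UNIV"
  and kernel_pow_summable: "(\<lambda>z. A x z * kernel_pow A n z y) summable_on UNIV"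
proof -
  have step: "(\<lambda>z. w x * (A x z * kernel_pow A n z y)) summable_on UNIV"
      "((\<lambda>x. w x * kernel_pow A (Suc n) x y) has_sum lam ^ Suc n * w y) UNIV"
    if IH: "((\<lambda>x. w x * kernel_pow A n x y) has_sum lam ^ n * w y) UNIV" for n x
  proof -
    let ?f = "\<lambda>z x. w x * (A x z * kernel_pow A n z y)"
    have nn: "0 \<le> ?f z x" for z x
      using w_pos[of x] A_nonneg kernel_pow_nonneg[of A] by (simp add: A_nonneg)
    have rows: "(?f z has_sum lam * (w z * kernel_pow A n z y)) UNIV" for z
      using has_sum_cmult_left[OF left_eigen[of z], of "kernel_pow A n z y"]
      by (simp add: mult_ac)
    have tot: "((\<lambda>z. lam * (w z * kernel_pow A n z y)) has_sum lam * (lam ^ n * w y)) UNIV"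
      using IH by (rule has_sum_cmult_right)
    show "(\<lambda>z. ?f z x) summable_on UNIV"
      by (rule tonelli_has_sum(1)[OF nn rows tot])
    have "((\<lambda>x. \<Sum>\<^sub>\<infinity>z. ?f z x) has_sum lam * (lam ^ n * w y)) UNIV"
      by (rule tonelli_has_sum(2)[OF nn rows tot])
    then show "((\<lambda>x. w x * kernel_pow A (Suc n) x y) has_sum lam ^ Suc n * w y) UNIV"
      by (simp add: infsum_cmult_right' mult.assoc)
  qed
  have main: "((\<lambda>x. w x * kernel_pow A n x y) has_sum lam ^ n * w y) UNIV" for n
  proof (induction n)
    case 0
    have "(\<lambda>x. w x * kernel_pow A 0 x y) = (\<lambda>x. if x = y then w x else 0)"
      by auto
    moreover have "((\<lambda>x. if x = y then w x else 0) has_sum w y) UNIV"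
      using has_sum_finite_neutralI[of "{y}" UNIV "\<lambda>x. if x = y then w x else 0" "w y"] by auto
    ultimately show ?case
      by simp
  qed (rule step(2))
  show "((\<lambda>x. w x * kernel_pow A n x y) has_sum lam ^ n * w y) UNIV"
    by (rule main)
  have "(\<lambda>z. inverse (w x) * (w x * (A x z * kernel_pow A n z y))) summable_on UNIV"
    by (intro summable_on_cmult_right step(1) main)
  moreover have "inverse (w x) * (w x * t) = t" for t
    using w_pos[of x] by simp
  ultimately show "(\<lambda>z. A x z * kernel_pow A n z y) summable_on UNIV"
    by simp
qed

text \<open>A single term of a nonnegative sum. This crude bound serves convergence: it makes the
  rows of the power summable against functions in \<open>l1 w\<close>.\<close>

lemma kernel_pow_le: "kernel_pow A n x y \<le> lam ^ n * w y / w x"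
proof -
  have "w x * kernel_pow A n x y \<le> lam ^ n * w y"
    using infsum_nonneg_ge_term[of "\<lambda>x. w x * kernel_pow A n x y" x]
      kernel_pow_left_eigen[of n y] w_pos kernel_pow_nonneg[of A, OF A_nonneg]
    by (simp add: has_sum_iff less_imp_le)
  then show ?thesis
    using w_pos[of x] by (simp add: field_simps)
qed

lemma kernel_pow_abs_summable:
  fixes f :: "'a \<Rightarrow> 'b::real_normed_vector"
  assumes "f \<in> l1 w"
  shows "(\<lambda>y. kernel_pow A n x y * norm (f y)) summable_on UNIV"
proof (rule summable_on_comparison_test)
  show "(\<lambda>y. lam ^ n / w x * (norm (f y) * w y)) summable_on UNIV"
    using assms by (intro summable_on_cmult_right) (simp add: l1_def)
  show "kernel_pow A n x y * norm (f y) \<le> lam ^ n / w x * (norm (f y) * w y)" for y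
    using mult_right_mono[OF kernel_pow_le[of n x y], of "norm (f y)"] by (simp add: mult_ac)
qed (simp add: kernel_pow_nonneg A_nonneg)

text \<open>Induction with Fubini; the double sum converges absolutely because the next power is
  summable against \<open>norm (f y)\<close>.\<close>

lemma operator_pow:
  fixes f :: "'a \<Rightarrow> 'b::banach"
  assumes f: "f \<in> l1 w"
  shows "((\<lambda>g x. \<Sum>\<^sub>\<infinity>y. A x y *\<^sub>R g y) ^^ n) f x = (\<Sum>\<^sub>\<infinity>y. kernel_pow A n x y *\<^sub>R f y)"
proof (induction n arbitrary: x)
  case 0
  have "(\<lambda>y. (if x = y then 1 else 0) *\<^sub>R f y) = (\<lambda>y. if y = x then f y else 0)"
    by auto
  then show ?case
    by (simp add: infsum_if_eq)
next
  case (Suc n)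
  let ?K = "kernel_pow A n"
  let ?F = "\<lambda>y z. (A x z * ?K z y) *\<^sub>R f y"
  have norm_F: "norm (?F y z) = (A x z * ?K z y) * norm (f y)" for y z
    by (simp add: kernel_pow_nonneg A_nonneg)
  have "(\<lambda>(y, z). norm (?F y z)) summable_on UNIV \<times> UNIV"
  proof (rule nonneg_kernel_summable_on_product)
    show "((\<lambda>z. norm (?F y z)) has_sum kernel_pow A (Suc n) x y * norm (f y)) UNIV" for y
      unfolding norm_F kernel_pow.simps
      by (intro has_sum_cmult_left has_sum_infsum kernel_pow_summable)
  qed (simp_all only: norm_ge_zero kernel_pow_abs_summable[OF f])
  then have "(\<lambda>p. norm ((\<lambda>(y, z). ?F y z) p)) summable_on UNIV \<times> UNIV"
    by (simp only: case_prod_unfold)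
  then have joint: "(\<lambda>(y, z). ?F y z) summable_on UNIV \<times> UNIV"
    by (rule abs_summable_summable)
  have "((\<lambda>g x. \<Sum>\<^sub>\<infinity>y. A x y *\<^sub>R g y) ^^ Suc n) f x = (\<Sum>\<^sub>\<infinity>z. A x z *\<^sub>R (\<Sum>\<^sub>\<infinity>y. ?K z y *\<^sub>R f y))"
    by (simp add: Suc)
  also have "\<dots> = (\<Sum>\<^sub>\<infinity>z. \<Sum>\<^sub>\<infinity>y. ?F y z)"
    by (simp add: infsum_scaleR_right[symmetric])
  also have "\<dots> = (\<Sum>\<^sub>\<infinity>y. \<Sum>\<^sub>\<infinity>z. ?F y z)"
    by (rule infsum_swap_banach[OF joint, symmetric])
  also have "\<dots> = (\<Sum>\<^sub>\<infinity>y. kernel_pow A (Suc n) x y *\<^sub>R f y)"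
    by (simp add: infsum_scaleR_left kernel_pow_summable)
  finally show ?case .
qed

text \<open>One direction tests the operator on the point mass at \<open>y\<close>, whose norm is
  \<open>\<phi> y * w y\<close>; the factor \<open>\<phi> y\<close> cancels and the kernel entry
  remains. The other estimates the kernel sum termwise. The factor \<open>lam ^ n\<close> goes into
  the constant.\<close>

lemma aIUC_iff_kernel_pow_le:
  assumes lam: "0 < lam" and \<phi>: "\<And>x. 0 < \<phi> x"
  shows "aIUC (\<lambda>g x. \<Sum>\<^sub>\<infinity>y. A x y *\<^sub>R g y) lam \<phi> (\<lambda>x. \<phi> x * w x) n \<longleftrightarrow>
    (\<exists>C. \<forall>x y. kernel_pow A n x y \<le> C * \<phi> x * w y)" (is "aIUC ?T _ _ ?\<nu> _ \<longleftrightarrow> _")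
proof
  assume "aIUC ?T lam \<phi> ?\<nu> n"
  then obtain C where C: "cmod (intrinsic_semigroup ?T lam \<phi> n f x) \<le> C * l1_norm ?\<nu> f"
    if "f \<in> l1 ?\<nu>" for f x
    unfolding aIUC_def by blast
  have "kernel_pow A n x y \<le> (C * lam ^ n) * \<phi> x * w y" for x y
  proof -
    define d :: "'a \<Rightarrow> complex" where "d = (\<lambda>z. if z = y then 1 else 0)"
    have finite_support: "g summable_on UNIV" if "\<And>z. z \<noteq> y \<Longrightarrow> g z = 0" for g :: "'a \<Rightarrow> real"
      using summable_on_cong_neutral[of UNIV "{y}" g g] that by auto
    have "(\<lambda>x. cmod (d x) * ?\<nu> x) = (\<lambda>x. if x = y then ?\<nu> x else 0)"
      by (auto simp: d_def)
    then have l1_norm_d: "l1_norm ?\<nu> d = ?\<nu> y"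
      by (simp add: l1_norm_def infsum_if_eq)
    have "d \<in> l1 ?\<nu>" "(\<lambda>z. \<phi> z *\<^sub>R d z) \<in> l1 w"
      unfolding l1_def by (auto intro!: finite_support simp: d_def)
    note d_in = this
    have "(\<lambda>z. kernel_pow A n x z *\<^sub>R (\<phi> z *\<^sub>R d z))
        = (\<lambda>z. if z = y then complex_of_real (kernel_pow A n x z * \<phi> z) else 0)"
      by (auto simp: d_def scaleR_conv_of_real)
    then have "(?T ^^ n) (\<lambda>z. \<phi> z *\<^sub>R d z) x = of_real (kernel_pow A n x y * \<phi> y)"
      by (subst operator_pow[OF d_in(2)]) (simp only: infsum_if_eq)
    then have "cmod (intrinsic_semigroup ?T lam \<phi> n d x)
        = kernel_pow A n x y * \<phi> y / (lam ^ n * \<phi> x)"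
      using lam \<phi>[of x] \<phi>[of y] kernel_pow_nonneg[of A, OF A_nonneg]
      by (simp add: intrinsic_semigroup_def norm_mult norm_divide norm_power abs_mult abs_of_pos)
    then have "kernel_pow A n x y * \<phi> y / (lam ^ n * \<phi> x) \<le> C * (\<phi> y * w y)"
      using C[OF d_in(1), of x] l1_norm_d by simp
    then have "\<phi> y * kernel_pow A n x y \<le> \<phi> y * ((C * lam ^ n) * \<phi> x * w y)"
      using lam \<phi>[of x] by (simp add: divide_le_eq mult_ac)
    then show ?thesis
      using \<phi>[of y] by simp
  qed
  then show "\<exists>C. \<forall>x y. kernel_pow A n x y \<le> C * \<phi> x * w y"
    by blast
next
  assume "\<exists>C. \<forall>x y. kernel_pow A n x y \<le> C * \<phi> x * w y"
  then obtain C where C: "kernel_pow A n x y \<le> C * \<phi> x * w y" for x y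
    by blast
  have "cmod (intrinsic_semigroup ?T lam \<phi> n f x) \<le> (C / lam ^ n) * l1_norm ?\<nu> f"
    if f: "f \<in> l1 ?\<nu>" for f :: "'a \<Rightarrow> complex" and x
  proof -
    have \<phi>f: "(\<lambda>y. \<phi> y *\<^sub>R f y) \<in> l1 w"
      using f \<phi> by (simp add: l1_def abs_of_pos mult_ac)
    have summ: "(\<lambda>y. norm (kernel_pow A n x y *\<^sub>R (\<phi> y *\<^sub>R f y))) summable_on UNIV"
      using kernel_pow_abs_summable[OF \<phi>f, of n x]
      by (simp add: kernel_pow_nonneg A_nonneg abs_mult mult.assoc)
    have "cmod ((?T ^^ n) (\<lambda>y. \<phi> y *\<^sub>R f y) x) = norm (\<Sum>\<^sub>\<infinity>y. kernel_pow A n x y *\<^sub>R (\<phi> y *\<^sub>R f y))"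
      by (subst operator_pow[OF \<phi>f]) simp
    also have "\<dots> \<le> (\<Sum>\<^sub>\<infinity>y. norm (kernel_pow A n x y *\<^sub>R (\<phi> y *\<^sub>R f y)))"
      by (rule norm_infsum_bound[OF summ])
    also have "\<dots> \<le> (\<Sum>\<^sub>\<infinity>y. C * \<phi> x * (norm (f y) * ?\<nu> y))"
    proof (rule infsum_mono[OF summ])
      show "(\<lambda>y. C * \<phi> x * (norm (f y) * ?\<nu> y)) summable_on UNIV"
        using f by (intro summable_on_cmult_right) (simp add: l1_def)
      show "norm (kernel_pow A n x y *\<^sub>R (\<phi> y *\<^sub>R f y)) \<le> C * \<phi> x * (norm (f y) * ?\<nu> y)" for y
        using mult_right_mono[OF C[of x y], of "\<phi> y * cmod (f y)"] \<phi>[of y]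
          kernel_pow_nonneg[of A n x y, OF A_nonneg]
        by (simp add: abs_of_nonneg mult_ac)
    qed
    also have "\<dots> = C * \<phi> x * l1_norm ?\<nu> f"
      by (simp add: infsum_cmult_right' l1_norm_def)
    finally show ?thesis
      using lam \<phi>[of x]
      by (simp add: intrinsic_semigroup_def norm_mult norm_divide norm_power abs_of_pos field_simps)
  qed
  then show "aIUC ?T lam \<phi> ?\<nu> n"
    unfolding aIUC_def by blast
qed

end

section \<open>Kernels with the two-step bound\<close>

text \<open>The larger of the two numbers dominates. With \<open>a\<close> and \<open>b\<close> the
  reciprocals of \<open>V\<close> at two points, all the weight moves to one of them.\<close>

lemma mult_power_le_add_power_Suc:
  fixes a b :: real
  assumes "0 \<le> a" "0 \<le> b"
  shows "a * b ^ k \<le> a ^ Suc k + b ^ Suc k"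
proof (cases "a \<le> b")
  case True
  then have "a * b ^ k \<le> b * b ^ k"
    using assms by (intro mult_right_mono) auto
  then show ?thesis
    using assms by (simp add: add_increasing)
next
  case False
  then have "a * b ^ k \<le> a * a ^ k"
    using assms by (intro mult_left_mono power_mono) auto
  then show ?thesis
    using assms by (simp add: add_increasing2)
qed

text \<open>The conditions are stable under exchange of the arguments of \<open>K\<close>, so the
  results apply to \<open>P\<close> and to its transpose. Convergence is demanded of the two-step
  sums rather than of the rows, since the columns of a subprobability kernel need not be
  summable.\<close>

locale dominated_kernel =
  fixes K :: "'a \<Rightarrow> 'a \<Rightarrow> real" and V :: "'a \<Rightarrow> real" and C c v :: real
  assumes K_pos: "0 < K x y"
    and two_step_summable: "(\<lambda>z. K x z * K z y) summable_on UNIV"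
    and two_step_le: "two_step K x y \<le> C * K x y"
    and c_pos: "0 < c"
    and diag_ge: "c \<le> K x x"
    and v_pos: "0 < v"
    and V_ge: "v \<le> V x"
    and confining: "confining V"
begin

lemma transpose: "dominated_kernel (\<lambda>x y. K y x) V C c v"
proof
  show "two_step (\<lambda>x y. K y x) x y \<le> C * K y x" for x y
    using two_step_le[of y x] by (simp add: two_step_def mult.commute)
  show "(\<lambda>z. K z x * K y z) summable_on UNIV" for x y
    using two_step_summable[of y x] by (simp add: mult.commute)
qed (fact K_pos c_pos diag_ge v_pos V_ge confining)+

section \<open>Column estimates and comparison with positive eigenfunctions\<close>

lemma V_pos: "0 < V x"
  using v_pos V_ge[of x] by linarith

text \<open>One term of the two-step sum. Division by \<open>K z y\<close> shows that any two
  columns of \<open>K\<close> are comparable.\<close>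

lemma K_mult_le: "K x z * K z y \<le> C * K x y"
  using infsum_nonneg_ge_term[OF two_step_summable, of x y z] two_step_le[of x y] K_pos
  by (simp add: two_step_def less_imp_le)

lemma C_pos: "0 < C"
proof (rule ccontr)
  assume "\<not> 0 < C"
  then have "C * K x x \<le> 0" for x
    using K_pos[of x x] by (simp add: mult_nonpos_nonneg)
  moreover have "0 < K x x * K x x" for x
    using K_pos[of x x] by simp
  ultimately show False
    using K_mult_le by (metis linorder_not_less order_trans)
qed

text \<open>Expanding \<open>S\<close> once more off a large finite set \<open>B\<close> bounds the contribution of the
  complement by \<open>S x / 2\<close>, thanks to the two-step bound; so \<open>S\<close> is controlled by finitely many
  columns of \<open>K\<close>, which are mutually comparable.\<close>

lemma ground_state_comparable:
  assumes S_pos: "\<And>x. 0 < S x" and lam: "0 < lam"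
    and S_eq: "\<And>x. ((\<lambda>y. K x y * (S y / (lam * V y))) has_sum S x) UNIV"
  obtains a b where "0 < a" "0 < b" "\<And>x. a * K x x0 \<le> S x" "\<And>x. S x \<le> b * K x x0"
proof -
  define g where "g = (\<lambda>y. S y / (lam * V y))"
  have g_pos: "0 < g y" for y
    using S_pos lam V_pos by (simp add: g_def)
  have S_eq': "((\<lambda>y. K x y * g y) has_sum S x) UNIV" for x
    using S_eq by (simp add: g_def)
  have lower: "g x0 * K x x0 \<le> S x" for x
    using infsum_nonneg_ge_term[of "\<lambda>y. K x y * g y" x0] S_eq'[of x] K_pos g_pos
    by (simp add: has_sum_iff less_imp_le mult.commute)
  \<comment> \<open>Writing \<open>S\<close> as \<open>K\<close> applied to \<open>g\<close> turns
    \<open>K\<close> applied to \<open>S\<close> into the two-step kernel applied to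
    \<open>g\<close>, which is at most \<open>C * S\<close>.\<close>
  have KS: "(\<lambda>y. K x y * S y) summable_on UNIV \<and> (\<Sum>\<^sub>\<infinity>y. K x y * S y) \<le> C * S x" for x
  proof -
    let ?f = "\<lambda>z y. K x y * (K y z * g z)"
    have nn: "0 \<le> ?f z y" for z y
      using K_pos g_pos by (simp add: less_imp_le)
    have rows: "(?f z has_sum two_step K x z * g z) UNIV" for z
      using has_sum_cmult_left[OF has_sum_infsum[OF two_step_summable], of x z "g z"]
      by (simp add: two_step_def mult.assoc)
    have dom: "two_step K x z * g z \<le> C * (K x z * g z)" for z
      using mult_right_mono[OF two_step_le[of x z], of "g z"] g_pos[of z] by simp
    have dom_sum: "((\<lambda>z. C * (K x z * g z)) has_sum C * S x) UNIV"
      using S_eq' by (rule has_sum_cmult_right)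
    have summ: "(\<lambda>z. two_step K x z * g z) summable_on UNIV"
    proof (rule summable_on_comparison_test[OF has_sum_imp_summable[OF dom_sum] dom])
      show "0 \<le> two_step K x z * g z" for z
        using g_pos[of z] K_pos by (simp add: two_step_def infsum_nonneg less_imp_le)
    qed
    have "((\<lambda>y. \<Sum>\<^sub>\<infinity>z. ?f z y) has_sum (\<Sum>\<^sub>\<infinity>z. two_step K x z * g z)) UNIV"
      by (rule tonelli_has_sum(2)[OF nn rows has_sum_infsum[OF summ]])
    moreover have "(\<Sum>\<^sub>\<infinity>z. ?f z y) = K x y * S y" for y
      using S_eq'[of y] by (simp add: infsum_cmult_right' infsumI)
    ultimately have "((\<lambda>y. K x y * S y) has_sum (\<Sum>\<^sub>\<infinity>z. two_step K x z * g z)) UNIV"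
      by simp
    moreover have "(\<Sum>\<^sub>\<infinity>z. two_step K x z * g z) \<le> C * S x"
      using has_sum_mono[OF has_sum_infsum[OF summ] dom_sum] dom by simp
    ultimately show ?thesis
      by (simp add: has_sum_iff)
  qed
  \<comment> \<open>With this choice \<open>C / (lam * M)\<close> is at most 1/2; the successor
    keeps \<open>M\<close> at least 1, as \<open>confining\<close> requires.\<close>
  define M where "M = Suc (nat \<lceil>2 * C / lam\<rceil>)"
  obtain B where B: "finite B" "\<And>x. x \<notin> B \<Longrightarrow> real M \<le> V x"
    using confining unfolding confining_def M_def by (metis One_nat_def le_add1 plus_1_eq_Suc)
  have M: "2 * C / lam \<le> M" "0 < M"
    unfolding M_def by (auto simp: le_nat_iff) linarith
  \<comment> \<open>The summand 1 keeps \<open>b\<close> positive even if \<open>B\<close> is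
    empty.\<close>
  define b where "b = 1 + (\<Sum>y\<in>B. 2 * C / K y x0 * g y)"
  have upper: "S x \<le> b * K x x0" for x
  proof -
    let ?h = "\<lambda>y. if y \<in> B then K x y * g y else 0"
    have h_sum: "(?h has_sum (\<Sum>y\<in>B. K x y * g y)) UNIV"
      by (rule has_sum_finite_neutralI[of B]) (use B in auto)
    have dom_sum: "((\<lambda>y. ?h y + 1 / (lam * M) * (K x y * S y)) has_sum
        (\<Sum>y\<in>B. K x y * g y) + 1 / (lam * M) * (\<Sum>\<^sub>\<infinity>y. K x y * S y)) UNIV"
      using KS[of x] by (intro has_sum_add h_sum has_sum_cmult_right has_sum_infsum) simp
    have "K x y * g y \<le> ?h y + 1 / (lam * M) * (K x y * S y)" for y
    proof (cases "y \<in> B")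
      case True
      then show ?thesis
        using K_pos[of x y] S_pos[of y] lam M(2) by simp
    next
      case False
      have "g y \<le> S y / (lam * M)"
        unfolding g_def using B(2)[OF False] S_pos[of y] lam M(2)
        by (intro divide_left_mono mult_left_mono mult_pos_pos V_pos) auto
      then show ?thesis
        using False mult_left_mono[OF \<open>g y \<le> _\<close> less_imp_le[OF K_pos[of x y]]] by simp
    qed
    then have "S x \<le> (\<Sum>y\<in>B. K x y * g y) + 1 / (lam * M) * (\<Sum>\<^sub>\<infinity>y. K x y * S y)"
      using has_sum_mono[OF S_eq' dom_sum] by blast
    also have "1 / (lam * M) * (\<Sum>\<^sub>\<infinity>y. K x y * S y) \<le> 1 / (lam * M) * (C * S x)"
      using KS[of x] lam M(2) by (intro mult_left_mono) auto
    also have "1 / (lam * M) * (C * S x) \<le> 1 / 2 * S x"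
    proof -
      have "1 / (lam * M) * C \<le> 1 / 2"
        using M lam by (simp add: field_simps)
      then show ?thesis
        using mult_right_mono[of "1 / (lam * M) * C" "1 / 2" "S x"] S_pos[of x]
        by (simp add: mult.assoc)
    qed
    \<comment> \<open>Half of \<open>S x\<close> is absorbed into the left side; only the columns in
      \<open>B\<close> remain.\<close>
    finally have "S x \<le> 2 * (\<Sum>y\<in>B. K x y * g y)"
      by simp
    also have "\<dots> = (\<Sum>y\<in>B. 2 * (K x y * g y))"
      by (simp add: sum_distrib_left)
    also have "\<dots> \<le> (\<Sum>y\<in>B. 2 * C / K y x0 * g y * K x x0)"
    proof (rule sum_mono)
      fix y
      have "K x y \<le> C * K x x0 / K y x0"
        using K_mult_le[of x y x0] K_pos[of y x0] by (simp add: le_divide_eq)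
      from mult_right_mono[OF this, of "2 * g y"]
      show "2 * (K x y * g y) \<le> 2 * C / K y x0 * g y * K x x0"
        using g_pos[of y] by (simp add: mult_ac)
    qed
    also have "\<dots> \<le> b * K x x0"
      using K_pos[of x x0] by (simp add: b_def sum_distrib_right distrib_right)
    finally show ?thesis .
  qed
  have "0 < b"
    unfolding b_def using C_pos K_pos g_pos
    by (intro add_pos_nonneg sum_nonneg) (auto intro!: mult_nonneg_nonneg simp: less_imp_le)
  then show thesis
    using that[OF g_pos _ lower upper] by blast
qed

section \<open>Bounds for kernel powers by weighted two-step sums\<close>

definition weighted_two_step :: "nat \<Rightarrow> 'a \<Rightarrow> 'a \<Rightarrow> real" where
  "weighted_two_step k x y = (\<Sum>\<^sub>\<infinity>z. K x z * K z y / V z ^ k)"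

lemma weighted_two_step_summable: "(\<lambda>z. K x z * K z y / V z ^ k) summable_on UNIV"
proof (rule summable_on_comparison_test)
  show "(\<lambda>z. K x z * K z y * (1 / v ^ k)) summable_on UNIV"
    by (intro summable_on_cmult_left two_step_summable)
  show "K x z * K z y / V z ^ k \<le> K x z * K z y * (1 / v ^ k)" for z
    using K_pos V_pos v_pos V_ge[of z]
    by (simp add: less_imp_le divide_left_mono power_mono mult_nonneg_nonneg)
  show "0 \<le> K x z * K z y / V z ^ k" for z
    using K_pos V_pos by (simp add: less_imp_le)
qed

text \<open>After the exchange of sums, the sum over \<open>z\<close> is a two-step sum from
  \<open>x\<close> to the weighted point \<open>u\<close> and collapses at the cost of
  \<open>C\<close>; the weight stays at \<open>u\<close>.\<close>

lemma K_weighted_two_step: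
  "(\<lambda>z. K x z * weighted_two_step k z y) summable_on UNIV"
  "(\<Sum>\<^sub>\<infinity>z. K x z * weighted_two_step k z y) \<le> C * weighted_two_step k x y"
proof -
  let ?f = "\<lambda>u z. K x z * (K z u * K u y / V u ^ k)"
  have nn: "0 \<le> ?f u z" for u z
    using K_pos V_pos by (simp add: less_imp_le)
  have rows: "(?f u has_sum two_step K x u * (K u y / V u ^ k)) UNIV" for u
    using has_sum_cmult_left[OF has_sum_infsum[OF two_step_summable], of x u "K u y / V u ^ k"]
    by (simp add: two_step_def mult.assoc)
  have dom: "two_step K x u * (K u y / V u ^ k) \<le> C * (K x u * K u y / V u ^ k)" for u
    using mult_right_mono[OF two_step_le[of x u], of "K u y / V u ^ k"] K_pos[of u y] V_pos[of u]
    by (simp add: less_imp_le mult.assoc)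
  have dom_sum: "((\<lambda>u. C * (K x u * K u y / V u ^ k)) has_sum C * weighted_two_step k x y) UNIV"
    unfolding weighted_two_step_def
    by (intro has_sum_cmult_right has_sum_infsum weighted_two_step_summable)
  have summ: "(\<lambda>u. two_step K x u * (K u y / V u ^ k)) summable_on UNIV"
  proof (rule summable_on_comparison_test[OF has_sum_imp_summable[OF dom_sum] dom])
    show "0 \<le> two_step K x u * (K u y / V u ^ k)" for u
      using K_pos V_pos by (simp add: two_step_def infsum_nonneg less_imp_le)
  qed
  have "((\<lambda>z. \<Sum>\<^sub>\<infinity>u. ?f u z) has_sum (\<Sum>\<^sub>\<infinity>u. two_step K x u * (K u y / V u ^ k))) UNIV"
    by (rule tonelli_has_sum(2)[OF nn rows has_sum_infsum[OF summ]])
  then have *: "((\<lambda>z. K x z * weighted_two_step k z y) has_sum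
      (\<Sum>\<^sub>\<infinity>u. two_step K x u * (K u y / V u ^ k))) UNIV"
    by (simp only: infsum_cmult_right' weighted_two_step_def)
  show "(\<lambda>z. K x z * weighted_two_step k z y) summable_on UNIV"
    using * by (rule has_sum_imp_summable)
  show "(\<Sum>\<^sub>\<infinity>z. K x z * weighted_two_step k z y) \<le> C * weighted_two_step k x y"
    using has_sum_mono[OF has_sum_infsum[OF summ] dom_sum] dom infsumI[OF *] by simp
qed

text \<open>The factor \<open>1 / V z\<close> and the weight \<open>1 / V u ^ k\<close> are merged
  at \<open>z\<close> or at \<open>u\<close>. In the first case the sum over \<open>u\<close>
  carries no weight and collapses to at most \<open>C * K z y\<close>.\<close>

lemma weighted_two_step_div_le:
  "weighted_two_step k z y / V z \<le> C * K z y / V z ^ Suc k + weighted_two_step (Suc k) z y"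
proof -
  have "((\<lambda>u. 1 / V z * (K z u * K u y / V u ^ k)) has_sum 1 / V z * weighted_two_step k z y) UNIV"
    unfolding weighted_two_step_def
    by (intro has_sum_cmult_right has_sum_infsum weighted_two_step_summable)
  moreover have "((\<lambda>u. 1 / V z ^ Suc k * (K z u * K u y) + K z u * K u y / V u ^ Suc k) has_sum
      1 / V z ^ Suc k * two_step K z y + weighted_two_step (Suc k) z y) UNIV"
    unfolding weighted_two_step_def two_step_def
    by (intro has_sum_add has_sum_cmult_right has_sum_infsum weighted_two_step_summable
        two_step_summable)
  moreover have "1 / V z * (K z u * K u y / V u ^ k)
      \<le> 1 / V z ^ Suc k * (K z u * K u y) + K z u * K u y / V u ^ Suc k" for u
    using mult_left_mono[OF mult_power_le_add_power_Suc[of "1 / V z" "1 / V u" k],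
        of "K z u * K u y"] K_pos V_pos
    by (simp add: less_imp_le power_one_over field_simps)
  ultimately have "1 / V z * weighted_two_step k z y
      \<le> 1 / V z ^ Suc k * two_step K z y + weighted_two_step (Suc k) z y"
    by (rule has_sum_mono)
  also have "1 / V z ^ Suc k * two_step K z y \<le> 1 / V z ^ Suc k * (C * K z y)"
    using V_pos[of z] by (intro mult_left_mono two_step_le) (simp add: less_imp_le)
  finally show ?thesis
    by simp
qed

text \<open>By induction all factors \<open>1 / V\<close> except the one at \<open>x\<close> are
  collected at a single intermediate point. Prepending a step adds a factor \<open>1 / V z\<close>;
  merging the weights gives two terms, each at most \<open>C\<close> times the new weighted
  sum.\<close>

lemma kernel_pow_le_weighted_two_step:
  "\<exists>D\<ge>0. \<forall>x y. kernel_pow (\<lambda>x y. K x y / V x) (Suc k) x y \<le> D / V x * weighted_two_step k x y"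
proof (induction k)
  case 0
  \<comment> \<open>The lower bound on the diagonal inserts an idle step, with \<open>x\<close>
    itself as intermediate point.\<close>
  have "K x y \<le> 1 / c * weighted_two_step 0 x y" for x y
  proof -
    have "c * K x y \<le> K x x * K x y"
      using diag_ge K_pos by (simp add: less_imp_le)
    also have "\<dots> \<le> weighted_two_step 0 x y"
      unfolding weighted_two_step_def
      using infsum_nonneg_ge_term[OF weighted_two_step_summable, of x y 0 x] K_pos
      by (simp add: less_imp_le)
    finally show ?thesis
      using c_pos by (simp add: field_simps)
  qed
  then have "\<forall>x y. kernel_pow (\<lambda>x y. K x y / V x) (Suc 0) x y \<le> (1 / c) / V x * weighted_two_step 0 x y"
    unfolding kernel_pow_1 using divide_right_mono[OF _ less_imp_le[OF V_pos]]
    by (metis times_divide_eq_left)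
  then show ?case
    using c_pos by (intro exI[of _ "1 / c"]) auto
next
  case (Suc k)
  let ?A = "\<lambda>x y. K x y / V x"
  let ?G = "weighted_two_step (Suc k)"
  from Suc obtain D where D: "0 \<le> D" "\<And>x y. kernel_pow ?A (Suc k) x y \<le> D / V x * weighted_two_step k x y"
    by blast
  have "kernel_pow ?A (Suc (Suc k)) x y \<le> D * (2 * C) / V x * ?G x y" for x y
  proof -
    have dom: "?A x z * kernel_pow ?A (Suc k) z y
        \<le> D / V x * (C * (K x z * K z y / V z ^ Suc k) + K x z * ?G z y)" for z
    proof -
      have "?A x z * kernel_pow ?A (Suc k) z y \<le> ?A x z * (D / V z * weighted_two_step k z y)"
        using K_pos V_pos by (intro mult_left_mono D) (simp add: less_imp_le)
      also have "\<dots> = D / V x * (K x z * (weighted_two_step k z y / V z))"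
        by simp
      also have "\<dots> \<le> D / V x * (K x z * (C * K z y / V z ^ Suc k + ?G z y))"
        using K_pos V_pos D(1) by (intro mult_left_mono weighted_two_step_div_le) (auto simp: less_imp_le)
      also have "\<dots> = D / V x * (C * (K x z * K z y / V z ^ Suc k) + K x z * ?G z y)"
        by (simp add: algebra_simps)
      finally show ?thesis .
    qed
    have dom_sum: "((\<lambda>z. D / V x * (C * (K x z * K z y / V z ^ Suc k) + K x z * ?G z y)) has_sum
        D / V x * (C * ?G x y + (\<Sum>\<^sub>\<infinity>z. K x z * ?G z y))) UNIV"
      unfolding weighted_two_step_def[of "Suc k" x y]
      by (intro has_sum_cmult_right has_sum_add has_sum_infsum weighted_two_step_summable
          K_weighted_two_step)
    have summ: "(\<lambda>z. ?A x z * kernel_pow ?A (Suc k) z y) summable_on UNIV"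
    proof (rule summable_on_comparison_test[OF has_sum_imp_summable[OF dom_sum] dom])
      show "0 \<le> ?A x z * kernel_pow ?A (Suc k) z y" for z
        using K_pos V_pos by (intro mult_nonneg_nonneg kernel_pow_nonneg) (auto simp: less_imp_le)
    qed
    have "kernel_pow ?A (Suc (Suc k)) x y \<le> D / V x * (C * ?G x y + (\<Sum>\<^sub>\<infinity>z. K x z * ?G z y))"
      using has_sum_mono[OF has_sum_infsum[OF summ] dom_sum dom]
      by (subst kernel_pow.simps(2))
    also have "\<dots> \<le> D / V x * (C * ?G x y + C * ?G x y)"
      using D(1) V_pos[of x] by (intro mult_left_mono add_left_mono K_weighted_two_step) simp
    finally show ?thesis
      by (simp add: algebra_simps)
  qed
  then show ?case
    using D(1) C_pos by (intro exI[of _ "D * (2 * C)"]) auto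
qed

text \<open>The hypothesis trades the weight at \<open>z\<close> for a loop from \<open>z\<close> to
  \<open>x0\<close> and back. In the path \<open>x\<close>, \<open>z\<close>, \<open>x0\<close>,
  \<open>z\<close>, \<open>y\<close> the part up to \<open>x0\<close> collapses for each
  \<open>z\<close>, the rest after summation over \<open>z\<close>.\<close>

lemma weighted_two_step_le:
  assumes "\<And>x. C' / V x ^ k \<le> K x x0 * K x0 x" "0 < C'"
  shows "weighted_two_step k x y \<le> C * C / C' * (K x x0 * K x0 y)"
proof -
  have dom: "K x z * K z y / V z ^ k \<le> C / C' * K x x0 * (K x0 z * K z y)" for z
  proof -
    have "1 / V z ^ k \<le> 1 / C' * (K z x0 * K x0 z)"
      using assms(1)[of z] assms(2) by (simp add: field_simps)
    then have "K x z * K z y * (1 / V z ^ k) \<le> K x z * K z y * (1 / C' * (K z x0 * K x0 z))"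
      using K_pos by (intro mult_left_mono) (auto simp: less_imp_le)
    also have "\<dots> = 1 / C' * (K x z * K z x0) * (K x0 z * K z y)"
      by simp
    also have "\<dots> \<le> 1 / C' * (C * K x x0) * (K x0 z * K z y)"
      using K_pos assms(2) by (intro mult_right_mono mult_left_mono K_mult_le) (auto simp: less_imp_le)
    finally show ?thesis
      by simp
  qed
  have "weighted_two_step k x y \<le> C / C' * K x x0 * two_step K x0 y"
    unfolding weighted_two_step_def two_step_def
    by (rule has_sum_mono[OF has_sum_infsum has_sum_cmult_right[OF has_sum_infsum] dom])
      (auto intro: weighted_two_step_summable two_step_summable)
  also have "\<dots> \<le> C / C' * K x x0 * (C * K x0 y)"
    using C_pos assms(2) K_pos by (intro mult_left_mono two_step_le) (auto simp: less_imp_le)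
  finally show ?thesis
    by (simp add: mult_ac)
qed

text \<open>The diagonal of the power and the upper comparison of \<open>S\<close> and
  \<open>R\<close> give one direction; the factor in \<open>S x / V x\<close> cancels one of the
  \<open>n\<close> factors \<open>1 / V x\<close>, hence the exponent \<open>n - 1\<close>. The
  converse combines the path estimates with the lower comparison.\<close>

theorem kernel_pow_le_ground_states_iff:
  assumes S_pos: "\<And>x. 0 < S x" and R_pos: "\<And>x. 0 < R x" and lam: "0 < lam"
    and S_eq: "\<And>x. ((\<lambda>y. K x y * (S y / (lam * V y))) has_sum S x) UNIV"
    and R_eq: "\<And>y. ((\<lambda>x. K x y * (R x / (lam * V x))) has_sum R y) UNIV"
    and n: "0 < n"
  shows "(\<exists>D. \<forall>x y. kernel_pow (\<lambda>x y. K x y / V x) n x y \<le> D * (S x / V x) * R y) \<longleftrightarrow>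
    (\<forall>x0. \<exists>D>0. \<forall>x. D / V x ^ (n - 1) \<le> K x x0 * K x0 x)" (is "?le \<longleftrightarrow> ?iii")
proof -
  let ?A = "\<lambda>x y. K x y / V x"
  obtain k where k: "n = Suc k"
    using n gr0_implies_Suc by blast
  note S_cmp = ground_state_comparable[OF S_pos lam S_eq]
  note R_cmp = dominated_kernel.ground_state_comparable[OF transpose R_pos lam R_eq]
  interpret left_eigen ?A R lam
  proof
    show "((\<lambda>x. R x * (K x y / V x)) has_sum lam * R y) UNIV" for y
      using has_sum_cmult_right[OF R_eq[of y], of lam] lam by (simp add: mult_ac)
  qed (use K_pos V_pos R_pos in \<open>auto simp: less_imp_le\<close>)
  \<comment> \<open>The path that never leaves \<open>x\<close> is one term of the power.\<close>
  have pow_ge: "(c / V x) ^ m \<le> kernel_pow ?A m x x" for x m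
  proof (induction m)
    case (Suc m)
    have "c / V x * (c / V x) ^ m \<le> ?A x x * kernel_pow ?A m x x"
      using Suc c_pos V_pos[of x] K_pos[of x x] diag_ge[of x]
      by (intro mult_mono divide_right_mono) (auto simp: less_imp_le)
    also have "\<dots> \<le> kernel_pow ?A (Suc m) x x"
      unfolding kernel_pow.simps
      by (rule infsum_nonneg_ge_term[where f = "\<lambda>z. ?A x z * kernel_pow ?A m z x"])
        (intro kernel_pow_summable mult_nonneg_nonneg A_nonneg kernel_pow_nonneg)+
    finally show ?case
      by simp
  qed simp
  show ?thesis
  proof
    assume ?le
    then obtain D where D: "kernel_pow ?A n x y \<le> D * (S x / V x) * R y" for x y
      by blast
    show ?iii
    proof
      fix x0
      obtain a b where ab: "0 < b" "\<And>x. S x \<le> b * K x x0"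
        by (rule S_cmp[of x0]) blast
      obtain a' b' where ab': "0 < b'" "\<And>x. R x \<le> b' * K x0 x"
        by (rule R_cmp[of x0]) blast
      \<comment> \<open>The sign of \<open>D\<close> is unknown, so \<open>\<bar>D\<bar> + 1\<close>
        replaces it.\<close>
      define D' where "D' = (\<bar>D\<bar> + 1) * b * b'"
      have D'_pos: "0 < D'"
        using ab ab' by (simp add: D'_def)
      have "c ^ n / D' / V x ^ (n - 1) \<le> K x x0 * K x0 x" for x
      proof -
        have "(c / V x) ^ n \<le> D * (S x / V x) * R x"
          using pow_ge[where m = n] D by (rule order_trans)
        also have "\<dots> \<le> (\<bar>D\<bar> + 1) * (S x / V x) * R x"
          using S_pos[of x] R_pos[of x] V_pos[of x] by (intro mult_right_mono) (auto simp: less_imp_le)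
        also have "\<dots> \<le> (\<bar>D\<bar> + 1) * (b * K x x0 / V x) * (b' * K x0 x)"
          using S_pos[of x] R_pos[of x] V_pos[of x] ab ab' K_pos[of x x0]
          by (intro mult_mono divide_right_mono) (auto simp: less_imp_le)
        also have "\<dots> = D' * (K x x0 * K x0 x) / V x"
          by (simp add: D'_def)
        finally show ?thesis
          using V_pos[of x] D'_pos unfolding k by (simp add: power_divide field_simps)
      qed
      moreover have "0 < c ^ n / D'"
        using c_pos D'_pos by simp
      ultimately show "\<exists>D>0. \<forall>x. D / V x ^ (n - 1) \<le> K x x0 * K x0 x"
        by blast
    qed
  next
    assume iii: ?iii
    \<comment> \<open>An arbitrary base point.\<close>
    define x0 :: 'a where "x0 = undefined"
    obtain C' where C': "0 < C'" "\<And>x. C' / V x ^ k \<le> K x x0 * K x0 x"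
      using iii k by auto
    obtain a b where ab: "0 < a" "\<And>x. a * K x x0 \<le> S x"
      by (rule S_cmp[of x0]) blast
    obtain a' b' where ab': "0 < a'" "\<And>x. a' * K x0 x \<le> R x"
      by (rule R_cmp[of x0]) blast
    obtain D where D: "0 \<le> D" "\<And>x y. kernel_pow ?A (Suc k) x y \<le> D / V x * weighted_two_step k x y"
      using kernel_pow_le_weighted_two_step by blast
    define D' where "D' = D * (C * C / C') / (a * a')"
    have "kernel_pow ?A n x y \<le> D' * (S x / V x) * R y" for x y
    proof -
      have "kernel_pow ?A n x y \<le> D / V x * (C * C / C' * (K x x0 * K x0 y))"
        unfolding k using D(1) V_pos[of x]
        by (intro order_trans[OF D(2)] mult_left_mono weighted_two_step_le C') (auto simp: less_imp_le)
      also have "\<dots> = D' * (a * K x x0 / V x) * (a' * K x0 y)"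
        using ab(1) ab'(1) by (simp add: D'_def mult_ac)
      also have "\<dots> \<le> D' * (S x / V x) * R y"
      proof -
        have "0 \<le> D'"
          using D(1) C_pos C' ab ab' by (simp add: D'_def)
        then show ?thesis
          using ab ab' K_pos[of x x0] K_pos[of x0 y] V_pos[of x] S_pos[of x]
          by (intro mult_mono divide_right_mono mult_nonneg_nonneg) (auto simp: less_imp_le)
      qed
      finally show ?thesis .
    qed
    then show ?le
      by blast
  qed
qed

end

section \<open>The Feynman--Kac operators\<close>

text \<open>The square \<open>(k - \<phi> * \<mu>)^2 \<ge> 0\<close> and
  \<open>k \<le> b * \<mu>\<close> bound \<open>k * \<phi>\<close> by a multiple of the summable
  \<open>k\<close> plus the summable \<open>\<phi>^2 * \<mu>\<close>.\<close>

lemma l2_summable_kernel_mult: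
  fixes k \<mu> \<phi> :: "'a \<Rightarrow> real"
  assumes "\<And>y. 0 \<le> k y" "k summable_on UNIV" "\<And>y. 0 < \<mu> y" "\<And>y. k y \<le> b * \<mu> y"
    and "\<phi> \<in> l2 \<mu>" "\<And>y. 0 \<le> \<phi> y"
  shows "(\<lambda>y. k y * \<phi> y) summable_on UNIV"
proof (rule summable_on_comparison_test)
  show "(\<lambda>y. b * k y + (norm (\<phi> y))\<^sup>2 * \<mu> y) summable_on UNIV"
    using assms by (intro summable_on_add summable_on_cmult_right) (auto simp: l2_def)
  show "k y * \<phi> y \<le> b * k y + (norm (\<phi> y))\<^sup>2 * \<mu> y" for y
  proof -
    have mono: "k y * k y \<le> k y * (b * \<mu> y)"
      using assms by (intro mult_left_mono) auto
    have "0 \<le> (k y - \<phi> y * \<mu> y)\<^sup>2"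
      by simp
    then have "2 * (k y * \<phi> y) * \<mu> y \<le> k y * k y + (\<phi> y)\<^sup>2 * \<mu> y * \<mu> y"
      by (simp add: power2_eq_square algebra_simps)
    also have "\<dots> \<le> (b * k y + (norm (\<phi> y))\<^sup>2 * \<mu> y) * \<mu> y"
      using mono by (simp add: algebra_simps)
    finally have "2 * (k y * \<phi> y) \<le> b * k y + (norm (\<phi> y))\<^sup>2 * \<mu> y"
      using assms(3)[of y] by simp
    moreover have "0 \<le> k y * \<phi> y"
      using assms by simp
    ultimately show ?thesis
      by linarith
  qed
qed (use assms in auto)

theorem theorem4p5:
  fixes P Ph :: "'a::countable \<Rightarrow> 'a \<Rightarrow> real"
    and \<mu> V \<phi>0 \<phi>h0 :: "'a \<Rightarrow> real"
    and lam0 Cs :: real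
    and n0 :: nat
  assumes "infinite (UNIV :: 'a set)"
    and "subprob_kernel P" and "subprob_kernel Ph"
    and "\<And>x. 0 < \<mu> x"
    and "\<And>x y. \<mu> x * P x y = \<mu> y * Ph y x"
    and "\<And>x y. 0 < P x y"
    and "1 \<le> Cs" and "\<And>x y. two_step P x y \<le> Cs * P x y"
    and "0 < (INF x. P x x)"
    and "bdd_above (range (\<lambda>(x, y). P x y / \<mu> y))"
    and "potential V" and "confining V"
    and "lam0 = l2_spectral_radius \<mu> (fk_op P V)"
    and "positive_normalized_eigenfunction \<mu> (fk_op P V) lam0 \<phi>0"
    and "positive_normalized_eigenfunction \<mu> (dual_fk_op Ph V) lam0 \<phi>h0"
    and "2 \<le> n0"
  shows "(aIUC (fk_op P V) lam0 \<phi>0 (intrinsic_measure \<mu> \<phi>0 \<phi>h0) n0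
            \<longleftrightarrow> aIUC (dual_fk_op Ph V) lam0 \<phi>h0 (intrinsic_measure \<mu> \<phi>0 \<phi>h0) n0)
       \<and> (aIUC (dual_fk_op Ph V) lam0 \<phi>h0 (intrinsic_measure \<mu> \<phi>0 \<phi>h0) n0
            \<longleftrightarrow> (\<forall>x0. \<exists>C>0. \<forall>x. C / V x ^ (n0 - 1) \<le> P x x0 * P x0 x))"
proof -
  note kernels = assms(2,3)
    and \<mu>_pos = assms(4) and dual = assms(5) and P_pos = assms(6)
    and eig = assms(14) and eigh = assms(15)
  have P_sum: "P x summable_on UNIV" and Ph_sum: "Ph x summable_on UNIV" and P_le_1: "P x y \<le> 1" for x y
    using kernels unfolding subprob_kernel_def by blast+
  have Ph_eq: "Ph x y = \<mu> y * P y x / \<mu> x" for x y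
    using dual[of y x] \<mu>_pos[of x] by (simp add: field_simps)
  obtain b where b: "P x y / \<mu> y \<le> b" for x y
    using assms(10) unfolding bdd_above_def by auto
  have P_le: "P x y \<le> b * \<mu> y" for x y
    using b[of x y] \<mu>_pos[of y] by (simp add: divide_le_eq)
  have Ph_le: "Ph x y \<le> b * \<mu> y" for x y
    using mult_left_mono[OF b[of y x], of "\<mu> y"] \<mu>_pos[of y] by (simp add: Ph_eq mult.commute)
  define v where "v = (INF x. V x)"
  have V_pos: "0 < V x" and v_pos: "0 < v" for x
    using assms(11) by (auto simp: potential_def v_def)
  have V_ge: "v \<le> V x" for x
    unfolding v_def using V_pos by (intro cINF_lower bdd_belowI[of _ 0]) (auto simp: less_imp_le)
  have diag: "(INF x. P x x) \<le> P x x" for x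
    using P_pos by (intro cINF_lower bdd_belowI[of _ 0]) (auto simp: less_imp_le)
  interpret P: dominated_kernel P V Cs "INF x. P x x" v
  proof
    show "(\<lambda>z. P x z * P z y) summable_on UNIV" for x y
      using P_le_1 P_pos
      by (intro summable_on_comparison_test[OF P_sum[of x]]) (auto simp: less_imp_le mult_left_le)
  qed (use assms diag v_pos V_ge in auto)
  interpret T: dominated_kernel "\<lambda>x y. P y x" V Cs "INF x. P x x" v
    by (rule P.transpose)

  have \<phi>_pos: "0 < \<phi>0 x" and \<phi>h_pos: "0 < \<phi>h0 x"
    and \<phi>_l2: "\<phi>0 \<in> l2 \<mu>" and \<phi>h_l2: "\<phi>h0 \<in> l2 \<mu>"
    and fk_eq: "fk_op P V \<phi>0 x = lam0 * \<phi>0 x"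
    and \<phi>h_eq: "(\<Sum>\<^sub>\<infinity>y. Ph x y * \<phi>h0 y / V y) = lam0 * \<phi>h0 x" for x
    using eig eigh by (simp_all add: positive_normalized_eigenfunction_def dual_fk_op_def)
  have \<phi>_eq: "(\<Sum>\<^sub>\<infinity>y. P x y * \<phi>0 y) = lam0 * V x * \<phi>0 x" for x
    using fk_eq[of x] V_pos[of x] by (simp add: fk_op_def divide_eq_eq mult.commute mult.left_commute)
  \<comment> \<open>The eigenvalue equation alone leaves convergence open; the bound on
    \<open>P x y / \<mu> y\<close> and \<open>\<phi>0 \<in> l2 \<mu>\<close> supply it.\<close>
  have \<phi>_summable: "(\<lambda>y. P x y * \<phi>0 y) summable_on UNIV" for x
    by (rule l2_summable_kernel_mult[OF _ P_sum \<mu>_pos P_le \<phi>_l2]) (auto simp: P_pos \<phi>_pos less_imp_le)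
  have Ph_nonneg: "0 \<le> Ph x y" for x y
    using P_pos \<mu>_pos by (simp add: Ph_eq less_imp_le)
  have "(\<lambda>y. Ph x y * \<phi>h0 y) summable_on UNIV" for x
    by (rule l2_summable_kernel_mult[OF Ph_nonneg Ph_sum \<mu>_pos Ph_le \<phi>h_l2]) (simp add: \<phi>h_pos less_imp_le)
  then have \<phi>h_summable: "(\<lambda>y. Ph x y * \<phi>h0 y / V y) summable_on UNIV" for x
  proof (rule summable_on_comparison_test[OF summable_on_cmult_left[of _ _ "1 / v"]])
    show "Ph x y * \<phi>h0 y / V y \<le> Ph x y * \<phi>h0 y * (1 / v)" for y
      using V_ge[of y] V_pos[of y] v_pos Ph_nonneg[of x y] \<phi>h_pos[of y]
      by (simp add: divide_left_mono less_imp_le)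
    show "0 \<le> Ph x y * \<phi>h0 y / V y" for y
      using Ph_nonneg[of x y] \<phi>h_pos[of y] V_pos[of y] by (simp add: less_imp_le)
  qed
  \<comment> \<open>The diagonal term at one point already makes the right side of the eigenvalue
    equation positive.\<close>
  have lam_pos: "0 < lam0"
  proof -
    fix x :: 'a
    have "0 < P x x * \<phi>0 x"
      using P_pos \<phi>_pos by simp
    also have "\<dots> \<le> lam0 * V x * \<phi>0 x"
      using infsum_nonneg_ge_term[OF \<phi>_summable, of x x] P_pos \<phi>_pos
      by (simp add: \<phi>_eq less_imp_le)
    finally show ?thesis
      using V_pos[of x] \<phi>_pos[of x] by (simp add: zero_less_mult_iff)
  qed
  have \<phi>_has_sum: "((\<lambda>y. P x y * \<phi>0 y) has_sum lam0 * V x * \<phi>0 x) UNIV" for x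
    using \<phi>_summable \<phi>_eq by (simp add: has_sum_iff)
  have \<phi>h_has_sum: "((\<lambda>x. P x y * (\<phi>h0 x * \<mu> x / V x)) has_sum lam0 * (\<phi>h0 y * \<mu> y)) UNIV" for y
  proof -
    have "((\<lambda>x. \<mu> y * (Ph y x * \<phi>h0 x / V x)) has_sum \<mu> y * (lam0 * \<phi>h0 y)) UNIV"
      using \<phi>h_summable \<phi>h_eq by (intro has_sum_cmult_right) (simp add: has_sum_iff)
    then show ?thesis
      using \<mu>_pos[of y] by (simp add: Ph_eq mult_ac)
  qed

  \<comment> \<open>The factors \<open>V\<close> and \<open>\<mu>\<close> bring the two eigenvalue
    equations to one form, for \<open>P\<close> and for its transpose, with
    \<open>1 / (lam0 * V)\<close> inside the sum.\<close>
  define S where "S = (\<lambda>x. V x * \<phi>0 x)"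
  define R where "R = (\<lambda>x. \<phi>h0 x * \<mu> x)"
  have S_pos: "0 < S x" and R_pos: "0 < R x" for x
    using V_pos \<phi>_pos \<phi>h_pos \<mu>_pos by (auto simp: S_def R_def)
  have S_eq: "((\<lambda>y. P x y * (S y / (lam0 * V y))) has_sum S x) UNIV" for x
  proof -
    have "(\<lambda>y. P x y * (S y / (lam0 * V y))) = (\<lambda>y. 1 / lam0 * (P x y * \<phi>0 y))"
      using V_pos by (auto simp: S_def less_imp_neq[symmetric])
    then show ?thesis
      using has_sum_cmult_right[OF \<phi>_has_sum[of x], of "1 / lam0"] lam_pos by (simp add: S_def)
  qed
  have R_eq: "((\<lambda>x. P x y * (R x / (lam0 * V x))) has_sum R y) UNIV" for y
    using has_sum_cmult_right[OF \<phi>h_has_sum[of y], of "1 / lam0"] lam_pos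
    by (simp add: R_def mult_ac)

  let ?iii = "\<forall>x0. \<exists>C>0. \<forall>x. C / V x ^ (n0 - 1) \<le> P x x0 * P x0 x"
  have n0: "0 < n0"
    using assms(16) by simp
  have "aIUC (fk_op P V) lam0 \<phi>0 (intrinsic_measure \<mu> \<phi>0 \<phi>h0) n0 \<longleftrightarrow> ?iii"
  proof -
    interpret left_eigen "\<lambda>x y. P x y / V x" R lam0
    proof
      show "((\<lambda>x. R x * (P x y / V x)) has_sum lam0 * R y) UNIV" for y
        using \<phi>h_has_sum[of y] by (simp add: R_def mult_ac)
    qed (use P_pos V_pos R_pos in \<open>auto simp: less_imp_le\<close>)
    have op: "fk_op P V = (\<lambda>(g::'a \<Rightarrow> complex) x. \<Sum>\<^sub>\<infinity>y. (P x y / V x) *\<^sub>R g y)"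
      by (simp add: fun_eq_iff fk_op_def infsum_scaleR_right[symmetric])
    have meas: "intrinsic_measure \<mu> \<phi>0 \<phi>h0 = (\<lambda>x. \<phi>0 x * R x)"
      by (simp add: fun_eq_iff intrinsic_measure_def R_def)
    have S_div: "S x / V x = \<phi>0 x" for x
      using V_pos[of x] by (simp add: S_def)
    show ?thesis
      unfolding op meas aIUC_iff_kernel_pow_le[OF lam_pos \<phi>_pos]
      using P.kernel_pow_le_ground_states_iff[OF S_pos R_pos lam_pos S_eq R_eq n0]
      by (simp only: S_div)
  qed
  moreover have "aIUC (dual_fk_op Ph V) lam0 \<phi>h0 (intrinsic_measure \<mu> \<phi>0 \<phi>h0) n0 \<longleftrightarrow> ?iii"
  proof -
    \<comment> \<open>Adjointness gives \<open>Ph x y / V y = h y / h x * (P y x / V x)\<close>: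
      conjugation moves the factor \<open>1 / V\<close> to the first argument of the transposed
      kernel.\<close>
    define h where "h = (\<lambda>x. \<mu> x / V x)"
    have h_pos: "0 < h x" for x
      using \<mu>_pos V_pos by (simp add: h_def)
    let ?A = "\<lambda>x y. h y / h x * (P y x / V x)"
    \<comment> \<open>By duality the left eigenfunction of the dual kernel comes from
      \<open>\<phi>0\<close>, and its product with \<open>\<phi>h0\<close> is again the intrinsic
      measure.\<close>
    let ?w = "\<lambda>x. \<phi>0 x * \<mu> x"
    interpret left_eigen ?A ?w lam0
    proof
      fix y
      have "(\<lambda>x. ?w x * ?A x y) = (\<lambda>x. \<mu> y / V y * (P y x * \<phi>0 x))"
        using \<mu>_pos V_pos by (auto simp: h_def less_imp_neq[symmetric])
      then show "((\<lambda>x. ?w x * ?A x y) has_sum lam0 * ?w y) UNIV"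
        using has_sum_cmult_right[OF \<phi>_has_sum[of y], of "\<mu> y / V y"] V_pos[of y] by (simp add: mult_ac)
    qed (use P_pos V_pos \<phi>_pos \<mu>_pos h_pos in \<open>auto simp: less_imp_le\<close>)
    have "Ph x y * (1 / V y) = ?A x y" for x y
      using V_pos[of x] by (simp add: Ph_eq h_def)
    then have op: "dual_fk_op Ph V = (\<lambda>(g::'a \<Rightarrow> complex) x. \<Sum>\<^sub>\<infinity>y. ?A x y *\<^sub>R g y)"
      by (simp only: fun_eq_iff dual_fk_op_def) simp
    have meas: "intrinsic_measure \<mu> \<phi>0 \<phi>h0 = (\<lambda>x. \<phi>h0 x * ?w x)"
      by (simp add: fun_eq_iff intrinsic_measure_def)
    \<comment> \<open>Both sides of the first estimate are those of the second multiplied by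
      \<open>h y / h x\<close>; \<open>S\<close> and \<open>R\<close> have exchanged roles.\<close>
    have "kernel_pow ?A n0 x y \<le> C * \<phi>h0 x * ?w y
        \<longleftrightarrow> kernel_pow (\<lambda>x y. P y x / V x) n0 x y \<le> C * (R x / V x) * S y" for C x y
    proof -
      have "kernel_pow ?A n0 x y = h y / h x * kernel_pow (\<lambda>x y. P y x / V x) n0 x y"
        using h_pos by (intro kernel_pow_conjugate) (auto simp: less_imp_neq[symmetric])
      moreover have "C * \<phi>h0 x * ?w y = h y / h x * (C * (R x / V x) * S y)"
        using \<mu>_pos[of x] V_pos[of x] V_pos[of y] by (simp add: h_def S_def R_def)
      moreover have "0 < h y / h x"
        using h_pos by simp
      ultimately show ?thesis
        by (simp only: mult_le_cancel_left_pos)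
    qed
    then have "aIUC (dual_fk_op Ph V) lam0 \<phi>h0 (intrinsic_measure \<mu> \<phi>0 \<phi>h0) n0 \<longleftrightarrow>
        (\<exists>C. \<forall>x y. kernel_pow (\<lambda>x y. P y x / V x) n0 x y \<le> C * (R x / V x) * S y)"
      unfolding op meas aIUC_iff_kernel_pow_le[OF lam_pos \<phi>h_pos] by simp
    \<comment> \<open>Transposition only reverses the order of the two factors in (iii).\<close>
    also have "\<dots> \<longleftrightarrow> (\<forall>x0. \<exists>C>0. \<forall>x. C / V x ^ (n0 - 1) \<le> P x0 x * P x x0)"
      by (rule T.kernel_pow_le_ground_states_iff[OF R_pos S_pos lam_pos R_eq S_eq n0])
    finally show ?thesis
      by (simp only: mult.commute)
  qed
  ultimately show ?thesis
    by blast
qed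

end
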